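(* Let $X$ be a real Banach space, let $O \subset X$ be an open and convex subset, let $f \colon O \to \mathbb{R}$ be convex and lower semicontinuous, and let $L > 0$ be fixed. Consider the following assertions. (i) ($f$ is strongly smooth) $f(\lambda x + (1-\lambda) y) + \frac{L}{2}\lambda(1-\lambda)\|y - x\|_X^2 \ge \lambda f(x) + (1-\lambda) f(y)$ for all $x, y \in O$ and $\lambda \in (0,1)$. (ii) (descent lemma) $f(y) \le f(x) + \langle x^\star, y - x\rangle_X + \frac{L}{2}\|y - x\|_X^2$ for all $x, y \in O$ and $x^\star \in \partial f(x)$. (iii) $\langle y^\star - x^\star, y - x\rangle_X \le L\|y - x\|_X^2$ for all $(x, x^\star), (y, y^\star) \in \operatorname{graph} \partial f$. (iv) (the subdifferential is Lipschitz continuous, thus single-valued) $\|y^\star - x^\star\|_{X^\star} \le L\|y - x\|_X$ for all $(x, x^\star), (y, y^\star) \in \operatorname{graph} \partial f$. (v) (the subdifferential is cocoercive) $\langle y^\star - x^\star, y - x\rangle_X \ge \frac{1}{L}\|y^\star - x^\star\|_{X^\star}^2$ for all $(x, x^\star), (y, y^\star) \in \operatorname{graph} \partial f$. (vi) $f(y) \ge f(x) + \langle x^\star, y - x\rangle_X + \frac{1}{2L}\|y^\star - x^\star\|_{X^\star}^2$ for all $(x, x^\star), (y, y^\star) \in \operatorname{graph} \partial f$. Each one of these conditions implies that $f$ is Gâteaux differentiable on $O$. Moreover, the following relations hold. (a) (i), (ii), (iii), (iv) are equivalent; moreover (vi) implies (v), and (v) implies (i). (b) If $X$ is a Hilbert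 space, then additionally (iv) and (v) are equivalent; hence (i), (ii), (iii), (iv), (v) are all equivalent, and these conditions are implied by (vi). (c) If $O = X$, then all of the assertions (i)–(vi) are equivalent.
   Context: $X^\star$ denotes the topological dual of $X$ with the dual norm $\|\cdot\|_{X^\star}$, and $\langle\cdot,\cdot\rangle_X$ is the duality pairing between $X^\star$ and $X$. For $x \in O$, the convex subdifferential is $\partial f(x) = \{x^\star \in X^\star : f(z) \ge f(x) + \langle x^\star, z - x\rangle_X \text{ for all } z \in O\}$, and $\operatorname{graph}\partial f = \{(x, x^\star) \in O \times X^\star : x^\star \in \partial f(x)\}$. Gâteaux differentiability of $f$ at $x \in O$ means that there is a continuous linear functional $f'(x) \in X^\star$ with $\lim_{t \to 0}(f(x + t h) - f(x))/t = \langle f'(x), h\rangle_X$ for all $h \in X$. *)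

theory Defs
  imports "HOL-Analysis.Analysis"
begin

text \<open>
  A function \<open>f : U \<rightarrow> \<real>\<close> on a subset \<open>U\<close> of \<open>X\<close> is represented by a total function
  \<open>'a \<Rightarrow> real\<close>; no definition below depends on its values outside \<open>U\<close> (for Gateaux
  differentiability because \<open>U\<close> is open). The dual space is the type \<open>'a \<Rightarrow>\<^sub>L real\<close> of bounded
  linear functionals with the operator norm.
\<close>

definition lower_semicontinuous_on :: "'a::topological_space set \<Rightarrow> ('a \<Rightarrow> real) \<Rightarrow> bool" where
  "lower_semicontinuous_on U f \<longleftrightarrow>
     (\<forall>x\<in>U. \<forall>c. c < f x \<longrightarrow> (\<forall>\<^sub>F y in at x within U. c < f y))"

definition subdifferential ::
  "'a::real_normed_vector set \<Rightarrow> ('a \<Rightarrow> real) \<Rightarrow> 'a \<Rightarrow> ('a \<Rightarrow>\<^sub>L real) set" where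
  "subdifferential U f x = {x'. \<forall>z\<in>U. f z \<ge> f x + blinfun_apply x' (z - x)}"

definition graph_subdifferential ::
  "'a::real_normed_vector set \<Rightarrow> ('a \<Rightarrow> real) \<Rightarrow> ('a \<times> ('a \<Rightarrow>\<^sub>L real)) set" where
  "graph_subdifferential U f = {(x, x'). x \<in> U \<and> x' \<in> subdifferential U f x}"

definition gateaux_differentiable_on ::
  "'a::real_normed_vector set \<Rightarrow> ('a \<Rightarrow> real) \<Rightarrow> bool" where
  "gateaux_differentiable_on U f \<longleftrightarrow>
     (\<forall>x\<in>U. \<exists>D :: 'a \<Rightarrow>\<^sub>L real. \<forall>h.
        ((\<lambda>t. (f (x + t *\<^sub>R h) - f x) / t) \<longlongrightarrow> blinfun_apply D h) (at (0::real)))"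

definition is_inner_product :: "('a::real_vector \<Rightarrow> 'a \<Rightarrow> real) \<Rightarrow> bool" where
  "is_inner_product ip \<longleftrightarrow>
     (\<forall>x y. ip x y = ip y x) \<and>
     (\<forall>x y z. ip (x + y) z = ip x z + ip y z) \<and>
     (\<forall>r x y. ip (r *\<^sub>R x) y = r * ip x y) \<and>
     (\<forall>x. x \<noteq> 0 \<longrightarrow> ip x x > 0)"

text \<open>
  A Hilbert space is a Banach space whose norm comes from an inner product. A predicate on the
  type, rather than the classes \<open>real_inner\<close> and \<open>complete_space\<close>, allows the Hilbert space
  hypothesis to be made on a given Banach space.
\<close>

definition hilbert_space :: "'a::banach itself \<Rightarrow> bool" where
  "hilbert_space _ \<longleftrightarrow>
     (\<exists>ip :: 'a \<Rightarrow> 'a \<Rightarrow> real. is_inner_product ip \<and> (\<forall>x. norm x = sqrt (ip x x)))"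

lemma hilbert_space_real_inner: "hilbert_space TYPE('a::{real_inner, banach})"
  unfolding hilbert_space_def is_inner_product_def
  by (rule exI[of _ inner])
    (auto simp: inner_commute inner_add_right norm_eq_sqrt_inner)

definition strongly_smooth ::
  "'a::real_normed_vector set \<Rightarrow> ('a \<Rightarrow> real) \<Rightarrow> real \<Rightarrow> bool" where
  "strongly_smooth U f L \<longleftrightarrow>
     (\<forall>x\<in>U. \<forall>y\<in>U. \<forall>t\<in>{0<..<1}.
        f (t *\<^sub>R x + (1 - t) *\<^sub>R y) + L / 2 * t * (1 - t) * (norm (y - x))\<^sup>2
          \<ge> t * f x + (1 - t) * f y)"

definition descent_property ::
  "'a::real_normed_vector set \<Rightarrow> ('a \<Rightarrow> real) \<Rightarrow> real \<Rightarrow> bool" where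
  "descent_property U f L \<longleftrightarrow>
     (\<forall>x\<in>U. \<forall>y\<in>U. \<forall>x'\<in>subdifferential U f x.
        f y \<le> f x + blinfun_apply x' (y - x) + L / 2 * (norm (y - x))\<^sup>2)"

definition subdiff_upper_monotone ::
  "'a::real_normed_vector set \<Rightarrow> ('a \<Rightarrow> real) \<Rightarrow> real \<Rightarrow> bool" where
  "subdiff_upper_monotone U f L \<longleftrightarrow>
     (\<forall>(x, x')\<in>graph_subdifferential U f. \<forall>(y, y')\<in>graph_subdifferential U f.
        blinfun_apply (y' - x') (y - x) \<le> L * (norm (y - x))\<^sup>2)"

definition subdiff_lipschitz ::
  "'a::real_normed_vector set \<Rightarrow> ('a \<Rightarrow> real) \<Rightarrow> real \<Rightarrow> bool" where
  "subdiff_lipschitz U f L \<longleftrightarrow>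
     (\<forall>(x, x')\<in>graph_subdifferential U f. \<forall>(y, y')\<in>graph_subdifferential U f.
        norm (y' - x') \<le> L * norm (y - x))"

definition subdiff_cocoercive ::
  "'a::real_normed_vector set \<Rightarrow> ('a \<Rightarrow> real) \<Rightarrow> real \<Rightarrow> bool" where
  "subdiff_cocoercive U f L \<longleftrightarrow>
     (\<forall>(x, x')\<in>graph_subdifferential U f. \<forall>(y, y')\<in>graph_subdifferential U f.
        blinfun_apply (y' - x') (y - x) \<ge> 1 / L * (norm (y' - x'))\<^sup>2)"

definition improved_subgradient_inequality ::
  "'a::real_normed_vector set \<Rightarrow> ('a \<Rightarrow> real) \<Rightarrow> real \<Rightarrow> bool" where
  "improved_subgradient_inequality U f L \<longleftrightarrow>
     (\<forall>(x, x')\<in>graph_subdifferential U f. \<forall>(y, y')\<in>graph_subdifferential U f.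
        f y \<ge> f x + blinfun_apply x' (y - x) + 1 / (2 * L) * (norm (y' - x'))\<^sup>2)"

end

theory Submission
  imports Defs
begin

text \<open>
  All six conditions except strong smoothness are vacuous where subgradients are missing, so
  the argument rests on \<open>subdifferential_nonempty\<close>. By the Baire category theorem, a lower
  semicontinuous function on an open subset of a Banach space is bounded above on some ball;
  convexity moves this bound to every point of \<open>U\<close>. It follows that the infimum of the
  difference quotients at a point is a sublinear functional dominated by a multiple of the
  norm, and the Hahn--Banach theorem gives a subgradient.

  Once subgradients exist, each of strong smoothness and upper monotonicity traps the difference
  \<open>f (x + h) - f x - x' h\<close> between \<open>0\<close> and a multiple of \<open>(norm h)\<^sup>2\<close>, which makes \<open>x'\<close>
  the Gateaux derivative at \<open>x\<close>. The descent inequality then comes from strong smoothness by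
  differentiating along the segment, and from upper monotonicity by integrating along it.
  Conversely, the descent inequality at an intermediate point of a segment, applied to the two
  endpoints, gives strong smoothness.

  The cycle is closed by deriving cocoercivity from the descent inequality. Comparing the
  subgradient inequality at \<open>x\<close> with the descent inequality at \<open>y\<close> in a common test point
  \<open>y - d\<close>, and optimising over \<open>d\<close>, gives the improved subgradient inequality. The
  optimal \<open>d\<close> has norm \<open>norm (y' - x') / L\<close>, and the test point has to lie in \<open>U\<close>. On
  the whole space this is no restriction. On a convex open set it holds when \<open>x\<close> and \<open>y\<close>
  are close together relative to their distance from the complement of \<open>U\<close>, so cocoercivity
  holds locally. Local cocoercivity is then added up over a fine subdivision of a segment: the
  increments \<open>\<delta> k\<close> of the subgradients over \<open>n\<close> equal steps satisfy
  \<open>n * (norm (\<delta> k))\<^sup>2 \<le> L * \<delta> k (y - x)\<close>, and the Cauchy--Schwarz inequality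
  for \<open>n\<close> terms absorbs exactly the factor \<open>n\<close>. The steps from cocoercivity to Lipschitz
  continuity and on to upper monotonicity are the bound of a functional by its norm.
\<close>


section \<open>Sublinear functionals and the Hahn--Banach theorem\<close>

definition sublinear :: "('a::real_vector \<Rightarrow> real) \<Rightarrow> bool" where
  "sublinear p \<longleftrightarrow>
     (\<forall>x y. p (x + y) \<le> p x + p y) \<and> (\<forall>x. \<forall>t>0. p (t *\<^sub>R x) = t * p x)"

lemma sublinear_add: "sublinear p \<Longrightarrow> p (x + y) \<le> p x + p y"
  and sublinear_scaleR: "sublinear p \<Longrightarrow> t > 0 \<Longrightarrow> p (t *\<^sub>R x) = t * p x"
  by (auto simp: sublinear_def)

lemma sublinear_0: "sublinear p \<Longrightarrow> p 0 = 0"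
  using sublinear_scaleR[of p 2 0] by simp

text \<open>
  Three sublinear functionals below are pointwise infima: the infimum of a chain, a modification
  of a sublinear functional in one direction, and the infimum of difference quotients. In each
  case the set of competitors at \<open>x\<close> is closed under the operations up to decreasing the value.
  Boundedness from below need not be checked at every \<open>x\<close>: adding a competitor at \<open>x\<close> and
  one at \<open>- x\<close> yields a competitor at \<open>0\<close>, and these are nonnegative.
\<close>
lemma sublinear_Inf:
  fixes F :: "'a::real_vector \<Rightarrow> real set"
  assumes ne: "\<And>x. F x \<noteq> {}"
    and zero: "\<And>c. c \<in> F 0 \<Longrightarrow> 0 \<le> c"
    and add: "\<And>x y a b. a \<in> F x \<Longrightarrow> b \<in> F y \<Longrightarrow> \<exists>c\<in>F (x + y). c \<le> a + b"
    and scale: "\<And>x a t. t > 0 \<Longrightarrow> a \<in> F x \<Longrightarrow> \<exists>c\<in>F (t *\<^sub>R x). c \<le> t * a"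
  shows "sublinear (\<lambda>x. Inf (F x))" and "a \<in> F x \<Longrightarrow> Inf (F x) \<le> a"
proof -
  have bdd: "bdd_below (F x)" for x
  proof -
    obtain b where "b \<in> F (- x)"
      using ne by blast
    then have "- b \<le> a" if "a \<in> F x" for a
      using add[OF that, of b "- x"] zero by force
    then show ?thesis
      by (rule bdd_belowI)
  qed
  show lower: "Inf (F x) \<le> a" if "a \<in> F x" for a x
    using that bdd by (rule cInf_lower)
  have add': "Inf (F (x + y)) \<le> Inf (F x) + Inf (F y)" for x y
  proof -
    have "Inf (F (x + y)) - b \<le> Inf (F x)" if "b \<in> F y" for b
    proof (rule cInf_greatest[OF ne])
      fix a assume "a \<in> F x"
      then show "Inf (F (x + y)) - b \<le> a"
        using add[OF _ that] lower by fastforce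
    qed
    then have "Inf (F (x + y)) - Inf (F x) \<le> Inf (F y)"
      by (intro cInf_greatest[OF ne]) force
    then show ?thesis
      by simp
  qed
  have scale_le: "Inf (F (t *\<^sub>R x)) \<le> t * Inf (F x)" if "t > 0" for t x
  proof -
    have "Inf (F (t *\<^sub>R x)) / t \<le> Inf (F x)"
    proof (rule cInf_greatest[OF ne])
      fix a assume "a \<in> F x"
      then have "Inf (F (t *\<^sub>R x)) \<le> t * a"
        using scale[OF that] lower by force
      then show "Inf (F (t *\<^sub>R x)) / t \<le> a"
        using that by (simp add: field_simps)
    qed
    then show ?thesis
      using that by (simp add: field_simps)
  qed
  have "Inf (F (t *\<^sub>R x)) = t * Inf (F x)" if "t > 0" for t x
    using scale_le[OF that, of x] scale_le[of "1 / t" "t *\<^sub>R x"] that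
    by (simp add: field_simps)
  with add' show "sublinear (\<lambda>x. Inf (F x))"
    by (simp add: sublinear_def)
qed

text \<open>
  The functional that assigns to \<open>x\<close> the infimum of \<open>q (x + t *\<^sub>R v) - t * q v\<close> over
  \<open>t \<ge> 0\<close> is sublinear and lies below \<open>q\<close>, so by minimality it equals \<open>q\<close>.
  Taking \<open>t = 1\<close> gives \<open>q x + q v \<le> q (x + v)\<close>, the converse of subadditivity.
\<close>
lemma minimal_sublinear_imp_linear:
  fixes q :: "'a::real_vector \<Rightarrow> real"
  assumes q: "sublinear q" and min: "\<And>r. sublinear r \<Longrightarrow> r \<le> q \<Longrightarrow> r = q"
  shows "linear q"
proof -
  have superadd: "q x + q v \<le> q (x + v)" for x v
  proof -
    define F where "F = (\<lambda>x. (\<lambda>t. q (x + t *\<^sub>R v) - t * q v) ` {0..})"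
    define r where "r = (\<lambda>x. Inf (F x))"
    have q0: "q (t *\<^sub>R v) = t * q v" if "t \<ge> 0" for t
      using that q sublinear_scaleR sublinear_0 by (cases "t = 0") auto
    have F: "F x \<noteq> {}" "c \<in> F 0 \<Longrightarrow> 0 \<le> c" for x c
      by (auto simp: F_def q0)
    have add: "\<exists>c\<in>F (x + y). c \<le> a + b" if ab: "a \<in> F x" "b \<in> F y" for a b x y
    proof -
      obtain s t where st: "s \<ge> 0" "t \<ge> 0" "a = q (x + s *\<^sub>R v) - s * q v"
          "b = q (y + t *\<^sub>R v) - t * q v"
        using ab by (auto simp: F_def)
      have "q (x + y + (s + t) *\<^sub>R v) \<le> q (x + s *\<^sub>R v) + q (y + t *\<^sub>R v)"
        using sublinear_add[OF q, of "x + s *\<^sub>R v" "y + t *\<^sub>R v"] by (simp add: algebra_simps)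
      then have "q (x + y + (s + t) *\<^sub>R v) - (s + t) * q v \<le> a + b"
        using st by (simp add: distrib_right)
      moreover have "q (x + y + (s + t) *\<^sub>R v) - (s + t) * q v \<in> F (x + y)"
        using st unfolding F_def by (intro image_eqI[of _ _ "s + t"]) auto
      ultimately show ?thesis
        by blast
    qed
    have scale: "\<exists>c\<in>F (t *\<^sub>R x). c \<le> t * a" if t: "t > 0" and a: "a \<in> F x" for x a t
    proof -
      obtain s where s: "s \<ge> 0" "a = q (x + s *\<^sub>R v) - s * q v"
        using a by (auto simp: F_def)
      have "q (t *\<^sub>R x + (t * s) *\<^sub>R v) = t * q (x + s *\<^sub>R v)"
        using sublinear_scaleR[OF q t, of "x + s *\<^sub>R v"] by (simp add: scaleR_add_right)
      then have "q (t *\<^sub>R x + (t * s) *\<^sub>R v) - (t * s) * q v \<le> t * a"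
        using s by (simp add: right_diff_distrib)
      moreover have "q (t *\<^sub>R x + (t * s) *\<^sub>R v) - (t * s) * q v \<in> F (t *\<^sub>R x)"
        using s t unfolding F_def by (intro image_eqI[of _ _ "t * s"]) auto
      ultimately show ?thesis
        by blast
    qed
    have "sublinear r"
      unfolding r_def by (rule sublinear_Inf; fact F add scale)
    have r_le: "r x \<le> a" if "a \<in> F x" for x a
      unfolding r_def by (rule sublinear_Inf(2)[of F]; fact F add scale that)
    have "r x \<le> q x" for x
      by (rule r_le) (auto simp: F_def image_iff intro!: bexI[of _ 0])
    then have "r = q"
      using \<open>sublinear r\<close> by (intro min) (simp_all add: le_fun_def)
    moreover have "r x \<le> q (x + v) - q v"
      by (rule r_le) (auto simp: F_def image_iff intro!: bexI[of _ 1])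
    ultimately show ?thesis
      by simp
  qed
  have add: "q (x + y) = q x + q y" for x y
    using superadd sublinear_add[OF q] by (intro antisym)
  have neg: "q (- x) = - q x" for x
    using add[of x "- x"] sublinear_0[OF q] by simp
  have "q (t *\<^sub>R x) = t * q x" for t x
  proof -
    consider "t > 0" | "t = 0" | "- t > 0"
      by linarith
    then show ?thesis
    proof cases
      case 3
      then show ?thesis
        using sublinear_scaleR[OF q, of "- t" x] neg[of "t *\<^sub>R x"] by simp
    qed (use sublinear_scaleR[OF q] sublinear_0[OF q] in auto)
  qed
  with add show ?thesis
    by (intro linearI) auto
qed

text \<open>
  This is the Hahn--Banach theorem with nothing prescribed on a subspace. Minimal elements among
  the sublinear functionals below \<open>p\<close> exist by Zorn's lemma, because the pointwise infimum of
  a chain of sublinear functionals is again sublinear; they are linear by the previous lemma.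
\<close>
theorem sublinear_dominates_linear:
  fixes p :: "'a::real_vector \<Rightarrow> real"
  assumes p: "sublinear p"
  obtains l where "linear l" and "l \<le> p"
proof -
  define A where "A = {q. sublinear q \<and> q \<le> p}"
  let ?ge = "\<lambda>(q :: 'a \<Rightarrow> real) r. r \<le> q"
  have "\<exists>m\<in>A. \<forall>a\<in>A. ?ge m a \<longrightarrow> a = m"
  proof (rule predicate_Zorn)
    show "partial_order_on A (relation_of ?ge A)"
      by (rule partial_order_on_relation_ofI) auto
    fix C assume C: "C \<in> Chains (relation_of ?ge A)"
    then have sub: "C \<subseteq> A"
      by (rule Chains_relation_of)
    have total: "q \<le> r \<or> r \<le> q" if "q \<in> C" "r \<in> C" for q r
      using C that by (auto simp: Chains_def relation_of_def)
    show "\<exists>u\<in>A. \<forall>a\<in>C. ?ge a u"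
    proof (cases "C = {}")
      case True
      then show ?thesis
        using p by (auto simp: A_def)
    next
      case False
      define F where "F = (\<lambda>x. (\<lambda>q. q x) ` C)"
      have F: "F x \<noteq> {}" "c \<in> F 0 \<Longrightarrow> 0 \<le> c" for x c
        using False sub by (auto simp: F_def A_def sublinear_0)
      have add: "\<exists>c\<in>F (x + y). c \<le> a + b" if ab: "a \<in> F x" "b \<in> F y" for a b x y
      proof -
        obtain q r where qr: "q \<in> C" "r \<in> C" "a = q x" "b = r y"
          using ab by (auto simp: F_def)
        \<comment> \<open>The smaller of the two functionals serves both summands.\<close>
        obtain s where s: "s \<in> C" "s \<le> q" "s \<le> r"
          using total[OF qr(1,2)] qr(1,2) by blast
        have "s (x + y) \<le> s x + s y"
          using s(1) sub by (auto simp: A_def sublinear_add)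
        also have "\<dots> \<le> a + b"
          using s qr by (simp add: add_mono le_funD)
        finally show ?thesis
          using s(1) by (auto simp: F_def)
      qed
      have scale: "\<exists>c\<in>F (t *\<^sub>R x). c \<le> t * a" if "t > 0" and "a \<in> F x" for x a t
        using that sub by (auto simp: F_def A_def sublinear_scaleR subset_iff)
      have subl: "sublinear (\<lambda>x. Inf (F x))"
        by (rule sublinear_Inf; fact F add scale)
      have lower: "Inf (F x) \<le> a" if "a \<in> F x" for x a
        by (rule sublinear_Inf(2)[of F]; fact F add scale that)
      have le: "(\<lambda>x. Inf (F x)) \<le> q" if "q \<in> C" for q
        using that by (intro le_funI lower) (simp add: F_def)
      obtain q where q: "q \<in> C"
        using False by blast
      have "(\<lambda>x. Inf (F x)) \<in> A"
        using le[OF q] q sub subl by (auto simp: A_def intro: order_trans)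
      with le show ?thesis
        by blast
    qed
  qed
  then obtain m where "m \<in> A" and "\<And>a. a \<in> A \<Longrightarrow> a \<le> m \<Longrightarrow> a = m"
    by blast
  then have "linear m" "m \<le> p"
    by (auto simp: A_def intro!: minimal_sublinear_imp_linear intro: order_trans)
  then show thesis
    by (rule that)
qed


section \<open>Existence of subgradients\<close>

lemma convex_onD_combination:
  assumes "convex_on U f" "x \<in> U" "y \<in> U" "u \<ge> 0" "v \<ge> 0" "u + v = 1"
  shows "f (u *\<^sub>R x + v *\<^sub>R y) \<le> u * f x + v * f y"
  using assms by (auto simp: convex_on_def)

text \<open>
  Lower semicontinuity makes the sublevel sets of \<open>f\<close> in a closed ball inside \<open>U\<close> closed.
  The ball is the union of the sublevel sets for integer levels, so by Baire's theorem one of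
  them has interior points. The proof works with the complements \<open>G n\<close> of these sets, which
  would otherwise all be open and dense.
\<close>
lemma lower_semicontinuous_bounded_above_somewhere:
  fixes U :: "'a::{real_normed_vector, complete_space} set" and f :: "'a \<Rightarrow> real"
  assumes U: "open U" "U \<noteq> {}" and lsc: "lower_semicontinuous_on U f"
  obtains z r M where "r > 0" "ball z r \<subseteq> U" "\<And>y. y \<in> ball z r \<Longrightarrow> f y \<le> M"
proof -
  obtain x r where x: "r > 0" "cball x r \<subseteq> U"
    using U open_contains_cball by blast
  define G where "G = (\<lambda>n::nat. {z. \<not> (z \<in> cball x r \<and> f z \<le> real n)})"
  have "open (G n)" for n
  proof (subst open_subopen, intro ballI)
    fix z assume z: "z \<in> G n"
    show "\<exists>T. open T \<and> z \<in> T \<and> T \<subseteq> G n"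
    proof (cases "z \<in> cball x r")
      case False
      then show ?thesis
        by (intro exI[of _ "- cball x r"]) (auto simp: G_def)
    next
      case True
      then have "z \<in> U" "real n < f z"
        using x z by (auto simp: G_def)
      then have "\<forall>\<^sub>F y in at z within U. real n < f y"
        using lsc by (simp add: lower_semicontinuous_on_def)
      then have "\<forall>\<^sub>F y in at z. real n < f y"
        using at_within_open[OF \<open>z \<in> U\<close> U(1)] by simp
      then obtain T where "open T" "z \<in> T" "\<And>y. y \<in> T \<Longrightarrow> y \<noteq> z \<Longrightarrow> real n < f y"
        unfolding eventually_at_topological by auto
      with \<open>real n < f z\<close> show ?thesis
        by (intro exI[of _ T]) (force simp: G_def)
    qed
  qed
  moreover have False if "\<And>n. closure (G n) = UNIV"
  proof -
    have "closure (\<Inter>(range G)) = UNIV"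
      using Met_TC.metric_Baire_category[of "range G"] \<open>\<And>n. open (G n)\<close> that
      by (auto simp: complete_UNIV)
    then have "\<exists>z\<in>\<Inter>(range G). dist z x < r"
      using x(1) closure_approachable[of x "\<Inter>(range G)"] by simp
    then obtain z where "z \<in> ball x r" "\<And>n. z \<in> G n"
      by (auto simp: dist_commute)
    moreover obtain n where "f z \<le> real n"
      using real_arch_simple by blast
    ultimately show False
      by (force simp: G_def)
  qed
  ultimately obtain n w where "w \<notin> closure (G n)"
    by blast
  then obtain d where "d > 0" "ball w d \<subseteq> - closure (G n)"
    using openE[of "- closure (G n)" w] by auto
  then have d: "d > 0" "\<And>y. y \<in> ball w d \<Longrightarrow> y \<notin> G n"
    using closure_subset[of "G n"] by auto
  show thesis
    by (rule that[of d w "real n"]) (use d x in \<open>auto simp: G_def\<close>)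
qed

text \<open>
  Extend the segment from the centre \<open>z\<close> of the good ball through \<open>x\<close> a little beyond
  \<open>x\<close> to a point \<open>w\<close> of \<open>U\<close>. The homothety with centre \<open>w\<close> that takes \<open>z\<close> to
  \<open>x\<close> takes the good ball to a ball around \<open>x\<close>, and convexity bounds \<open>f\<close> there by the
  values at \<open>w\<close> and on the good ball.
\<close>
lemma convex_lower_semicontinuous_bounded_above_near:
  fixes U :: "'a::{real_normed_vector, complete_space} set" and f :: "'a \<Rightarrow> real"
  assumes U: "open U" and cvx: "convex_on U f" and lsc: "lower_semicontinuous_on U f"
    and x: "x \<in> U"
  obtains r M where "r > 0" "cball x r \<subseteq> U" "\<And>y. y \<in> cball x r \<Longrightarrow> f y \<le> M"
proof -
  have "U \<noteq> {}"
    using x by blast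
  with U obtain z r M
    where z: "r > 0" "ball z r \<subseteq> U" "\<And>y. y \<in> ball z r \<Longrightarrow> f y \<le> M"
    using lsc by (rule lower_semicontinuous_bounded_above_somewhere) blast
  have "((\<lambda>s. x + s *\<^sub>R (x - z)) \<longlongrightarrow> x + 0 *\<^sub>R (x - z)) (at_right 0)"
    by (intro tendsto_intros)
  then have "\<forall>\<^sub>F s in at_right 0. x + s *\<^sub>R (x - z) \<in> U"
    by (rule topological_tendstoD) (use U x in simp_all)
  moreover have "\<forall>\<^sub>F s in at_right (0::real). s > 0"
    by (rule eventually_at_right_less)
  ultimately have "\<forall>\<^sub>F s in at_right (0::real). s > 0 \<and> x + s *\<^sub>R (x - z) \<in> U"
    by eventually_elim simp
  then obtain s where s: "s > 0" "x + s *\<^sub>R (x - z) \<in> U"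
    using eventually_happens'[OF trivial_limit_at_right_real] by blast
  define w where "w = x + s *\<^sub>R (x - z)"
  define u where "u = 1 / (1 + s)"
  define v where "v = s / (1 + s)"
  have uv: "u > 0" "v > 0" "u + v = 1"
    using s by (auto simp: u_def v_def field_simps)
  have x_eq: "x = u *\<^sub>R w + v *\<^sub>R z"
  proof -
    have "(1 + s) *\<^sub>R x = w + s *\<^sub>R z"
      by (simp add: w_def algebra_simps)
    then have "u *\<^sub>R (1 + s) *\<^sub>R x = u *\<^sub>R w + v *\<^sub>R z"
      by (simp add: scaleR_add_right u_def v_def)
    then show ?thesis
      using s by (simp add: u_def)
  qed
  have bound: "y \<in> U \<and> f y \<le> u * f w + v * M" if "y \<in> cball x (v * r / 2)" for y
  proof -
    \<comment> \<open>The preimage of \<open>y\<close> under the homothety.\<close>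
    define y' where "y' = z + (1 / v) *\<^sub>R (y - x)"
    have "norm (y - x) \<le> v * r / 2"
      using that by (simp add: dist_norm norm_minus_commute)
    also have "\<dots> < v * r"
      using uv z(1) by simp
    finally have "norm (y - x) / v < r"
      using uv by (simp add: divide_less_eq mult.commute)
    then have y': "y' \<in> ball z r"
      using uv z(1) by (simp add: y'_def dist_norm)
    have y_eq: "y = u *\<^sub>R w + v *\<^sub>R y'"
    proof -
      have "u *\<^sub>R w + v *\<^sub>R y' = (u *\<^sub>R w + v *\<^sub>R z) + (y - x)"
        using uv by (simp add: y'_def scaleR_add_right)
      then show ?thesis
        by (simp flip: x_eq)
    qed
    have "y \<in> U"
      unfolding y_eq using cvx s y' z uv by (intro convexD) (auto simp: w_def convex_on_def)
    moreover have "f y \<le> u * f w + v * f y'"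
      unfolding y_eq using cvx s y' z uv by (intro convex_onD_combination) (auto simp: w_def)
    moreover have "v * f y' \<le> v * M"
      using y' z uv by (intro mult_left_mono) auto
    ultimately show ?thesis
      by simp
  qed
  \<comment> \<open>The factor \<open>1 / 2\<close> fits a closed ball into the open ball of radius \<open>v * r\<close>.\<close>
  show thesis
    by (rule that[of "v * r / 2" "u * f w + v * M"]) (use bound uv z in auto)
qed

text \<open>
  For convex \<open>f\<close> the infimum of the difference quotients in direction \<open>h\<close> is the one-sided
  directional derivative, but the infimum is easier to handle than the limit. A linear functional
  below it satisfies the subgradient inequality (use the quotient with \<open>t = 1\<close>). It is bounded
  because a quotient whose step ends on a sphere around \<open>x\<close> is at most a multiple of \<open>norm h\<close>.
\<close>
theorem subdifferential_nonempty:
  fixes U :: "'a::banach set" and f :: "'a \<Rightarrow> real"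
  assumes U: "open U" and cvx: "convex_on U f" and lsc: "lower_semicontinuous_on U f"
    and x: "x \<in> U"
  obtains x' where "x' \<in> subdifferential U f x"
proof -
  have convU: "convex U"
    using cvx by (simp add: convex_on_def)
  obtain r M where r: "r > 0" "cball x r \<subseteq> U" "\<And>y. y \<in> cball x r \<Longrightarrow> f y \<le> M"
    using convex_lower_semicontinuous_bounded_above_near[OF assms] by blast
  define F where
    "F = (\<lambda>h. {(f (x + t *\<^sub>R h) - f x) / t |t. t > 0 \<and> x + t *\<^sub>R h \<in> U})"
  have bound: "\<exists>a\<in>F h. a \<le> (M - f x) / r * norm h" for h
  proof (cases "h = 0")
    case True
    then show ?thesis
      using x by (auto simp: F_def intro!: exI[of _ 1])
  next
    case False
    define t where "t = r / norm h"
    have t: "t > 0" "x + t *\<^sub>R h \<in> cball x r"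
      using False r(1) by (auto simp: t_def dist_norm)
    then have "(f (x + t *\<^sub>R h) - f x) / t \<le> (M - f x) / t"
      using r by (intro divide_right_mono) auto
    moreover have "(M - f x) / t = (M - f x) / r * norm h"
      using False r(1) by (simp add: t_def)
    moreover have "(f (x + t *\<^sub>R h) - f x) / t \<in> F h"
      using t r(2) by (auto simp: F_def)
    ultimately show ?thesis
      by auto
  qed
  have add: "\<exists>c\<in>F (h + k). c \<le> a + b" if ab: "a \<in> F h" "b \<in> F k" for a b h k
  proof -
    obtain s t where s: "s > 0" "x + s *\<^sub>R h \<in> U" "a = (f (x + s *\<^sub>R h) - f x) / s"
      and t: "t > 0" "x + t *\<^sub>R k \<in> U" "b = (f (x + t *\<^sub>R k) - f x) / t"
      using ab by (auto simp: F_def)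
    \<comment> \<open>The weights for which the two endpoints combine to a multiple of \<open>h + k\<close> added to \<open>x\<close>;
        the resulting step length \<open>u * s\<close> is half the harmonic mean of \<open>s\<close> and \<open>t\<close>.\<close>
    define u where "u = t / (s + t)"
    define v where "v = s / (s + t)"
    have uv: "u \<ge> 0" "v \<ge> 0" "u + v = 1" "v * t = u * s" "u * s > 0"
      using s(1) t(1) add_pos_pos[OF s(1) t(1)]
      by (simp_all add: u_def v_def add.commute flip: add_divide_distrib)
    have eq: "x + (u * s) *\<^sub>R (h + k) = u *\<^sub>R (x + s *\<^sub>R h) + v *\<^sub>R (x + t *\<^sub>R k)"
      using uv by (simp add: scaleR_add_right flip: scaleR_add_left)
    have "f (x + (u * s) *\<^sub>R (h + k)) \<le> u * f (x + s *\<^sub>R h) + v * f (x + t *\<^sub>R k)"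
      unfolding eq using cvx s t uv by (intro convex_onD_combination) auto
    also have "\<dots> = u * (f x + s * a) + v * (f x + t * b)"
      using s t by simp
    also have "\<dots> = f x + (u * s) * (a + b)"
      using uv by (simp add: algebra_simps) (metis distrib_left mult.right_neutral mult.assoc mult.commute)
    finally have "(f (x + (u * s) *\<^sub>R (h + k)) - f x) / (u * s) \<le> a + b"
      using uv(5) by (simp add: divide_le_eq mult.commute)
    moreover have "x + (u * s) *\<^sub>R (h + k) \<in> U"
      unfolding eq using convU s t uv by (intro convexD) auto
    ultimately show ?thesis
      using uv(5) by (auto simp: F_def)
  qed
  have scale: "\<exists>c\<in>F (t *\<^sub>R h). c \<le> t * a" if t: "t > 0" and a: "a \<in> F h" for a h t
  proof -
    obtain s where s: "s > 0" "x + s *\<^sub>R h \<in> U" "a = (f (x + s *\<^sub>R h) - f x) / s"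
      using a by (auto simp: F_def)
    then have "t * a = (f (x + (s / t) *\<^sub>R t *\<^sub>R h) - f x) / (s / t)"
      "s / t > 0" "x + (s / t) *\<^sub>R t *\<^sub>R h \<in> U"
      using t by simp_all
    then have "t * a \<in> F (t *\<^sub>R h)"
      unfolding F_def by blast
    then show ?thesis
      by blast
  qed
  have F: "F h \<noteq> {}" "c \<in> F 0 \<Longrightarrow> 0 \<le> c" for h c
    using bound[of h] by (auto simp: F_def)
  have "sublinear (\<lambda>h. Inf (F h))"
    by (rule sublinear_Inf; fact F add scale)
  then obtain l where l: "linear l" "l \<le> (\<lambda>h. Inf (F h))"
    using sublinear_dominates_linear by blast
  have le: "l h \<le> a" if "a \<in> F h" for h a
  proof -
    have "Inf (F h) \<le> a"
      by (rule sublinear_Inf(2)[of F]; fact F add scale that)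
    then show ?thesis
      using le_funD[OF l(2), of h] by simp
  qed
  have upper: "l h \<le> (M - f x) / r * norm h" for h
    using bound[of h] le by force
  have "bounded_linear l"
  proof (rule bounded_linear_intro)
    show "norm (l h) \<le> norm h * ((M - f x) / r)" for h
      using upper[of h] upper[of "- h"] linear_neg[OF l(1), of h] by (simp add: mult.commute)
  qed (use l(1) in \<open>auto simp: linear_add linear_scale\<close>)
  then have "blinfun_apply (Blinfun l) = l"
    by (rule bounded_linear_Blinfun_apply)
  moreover have "f x + l (z - x) \<le> f z" if "z \<in> U" for z
    using le[of "f z - f x" "z - x"] that by (force simp: F_def intro!: exI[of _ 1])
  ultimately show thesis
    by (intro that[of "Blinfun l"]) (auto simp: subdifferential_def)
qed


section \<open>Gateaux differentiability from a quadratic upper bound\<close>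

lemma subdifferentialD: "x' \<in> subdifferential U f x \<Longrightarrow> z \<in> U \<Longrightarrow> f x + x' (z - x) \<le> f z"
  by (simp add: subdifferential_def)

text \<open>
  The subgradient inequality bounds the error of the linear approximation from below by \<open>0\<close>, for
  steps of both signs. With the quadratic upper bound, the difference quotient with step \<open>t\<close>
  deviates from \<open>x' h\<close> by \<open>O(\<bar>t\<bar>)\<close>. The bound is asked for only where \<open>x - h\<close>
  is in \<open>U\<close> as well, since strong smoothness yields it from the pair \<open>x + h\<close>, \<open>x - h\<close>.
\<close>
lemma quadratic_bound_imp_gateaux_derivative:
  fixes U :: "'a::real_normed_vector set" and f :: "'a \<Rightarrow> real"
  assumes U: "open U" and x: "x \<in> U" and x': "x' \<in> subdifferential U f x"
    and upper: "\<And>h. x + h \<in> U \<Longrightarrow> x - h \<in> U \<Longrightarrow> f (x + h) \<le> f x + x' h + C * (norm h)\<^sup>2"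
  shows "((\<lambda>t. (f (x + t *\<^sub>R h) - f x) / t) \<longlongrightarrow> x' h) (at 0)"
proof -
  have near: "\<forall>\<^sub>F t in at 0. x + t *\<^sub>R k \<in> U" for k
  proof -
    have "((\<lambda>t. x + t *\<^sub>R k) \<longlongrightarrow> x + 0 *\<^sub>R k) (at 0)"
      by (intro tendsto_intros)
    then show ?thesis
      by (rule topological_tendstoD) (use U x in simp_all)
  qed
  have "\<forall>\<^sub>F t in at 0. norm ((f (x + t *\<^sub>R h) - f x) / t - x' h) \<le> C * (norm h)\<^sup>2 * \<bar>t\<bar>"
    using near[of h] near[of "- h"] eventually_neq_at_within[of 0 0 UNIV]
  proof eventually_elim
    case (elim t)
    define e where "e = f (x + t *\<^sub>R h) - f x - t * x' h"
    have "0 \<le> e"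
      using subdifferentialD[OF x' elim(1)] by (simp add: e_def blinfun.scaleR_right)
    moreover have "e \<le> C * (norm h)\<^sup>2 * \<bar>t\<bar> * \<bar>t\<bar>"
      using upper[of "t *\<^sub>R h"] elim
      by (simp add: e_def blinfun.scaleR_right power2_eq_square algebra_simps)
    moreover have "(f (x + t *\<^sub>R h) - f x) / t - x' h = e / t"
      using elim by (simp add: e_def field_simps)
    ultimately show ?case
      using elim by (simp add: divide_le_eq)
  qed
  moreover have "((\<lambda>t::real. C * (norm h)\<^sup>2 * \<bar>t\<bar>) \<longlongrightarrow> 0) (at 0)"
    by (auto intro!: tendsto_eq_intros)
  ultimately have "((\<lambda>t. (f (x + t *\<^sub>R h) - f x) / t - x' h) \<longlongrightarrow> 0) (at 0)"
    by (rule Lim_null_comparison)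
  then show ?thesis
    by (rule LIM_zero_cancel)
qed

text \<open>
  The quadratic bound comes from the subgradient inequality at \<open>x + h\<close>, read backwards:
  \<open>f (x + h) \<le> f x + y' h\<close>, where \<open>y' h\<close> exceeds \<open>x' h\<close> by at most
  \<open>L * (norm h)\<^sup>2\<close>.
\<close>
lemma upper_monotone_imp_gateaux_derivative:
  fixes U :: "'a::real_normed_vector set" and f :: "'a \<Rightarrow> real"
  assumes U: "open U" and ne: "\<And>x. x \<in> U \<Longrightarrow> \<exists>x'. x' \<in> subdifferential U f x"
    and mono: "subdiff_upper_monotone U f L"
    and x: "x \<in> U" and x': "x' \<in> subdifferential U f x"
  shows "((\<lambda>t. (f (x + t *\<^sub>R h) - f x) / t) \<longlongrightarrow> x' h) (at 0)"
proof (rule quadratic_bound_imp_gateaux_derivative[OF U x x'])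
  fix h assume h: "x + h \<in> U"
  obtain y' where y': "y' \<in> subdifferential U f (x + h)"
    using ne[OF h] by blast
  have "(y' - x') (x + h - x) \<le> L * (norm (x + h - x))\<^sup>2"
    using mono x x' h y' unfolding subdiff_upper_monotone_def graph_subdifferential_def by blast
  moreover have "f (x + h) + y' (x - (x + h)) \<le> f x"
    using y' x by (rule subdifferentialD)
  ultimately show "f (x + h) \<le> f x + x' h + L * (norm h)\<^sup>2"
    by (simp add: blinfun.diff_left blinfun.minus_right)
qed


section \<open>Equivalences on a convex open set\<close>

text \<open>
  Strong smoothness at the midpoint \<open>x\<close> of \<open>x + h\<close> and \<open>x - h\<close>, together with the
  subgradient inequality at \<open>x - h\<close>, gives the quadratic bound. Hence \<open>x'\<close> is the derivative
  at \<open>x\<close>, and the descent inequality is the limit of strong smoothness for weight \<open>t\<close> at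
  \<open>y\<close> as \<open>t\<close> tends to \<open>0\<close>.
\<close>
lemma strongly_smooth_imp_descent:
  fixes U :: "'a::real_normed_vector set" and f :: "'a \<Rightarrow> real"
  assumes U: "open U" and smooth: "strongly_smooth U f L"
  shows "descent_property U f L"
  unfolding descent_property_def
proof (intro ballI)
  fix x y x' assume x: "x \<in> U" and y: "y \<in> U" and x': "x' \<in> subdifferential U f x"
  have "f (x + h) \<le> f x + x' h + L * (norm h)\<^sup>2" if h: "x + h \<in> U" "x - h \<in> U" for h
  proof -
    have mid: "(1 / 2) *\<^sub>R (x + h) + (1 - 1 / 2) *\<^sub>R (x - h) = x"
      by (simp add: algebra_simps flip: scaleR_add_left)
    have "(1 / 2) * f (x + h) + (1 - 1 / 2) * f (x - h)
        \<le> f ((1 / 2) *\<^sub>R (x + h) + (1 - 1 / 2) *\<^sub>R (x - h))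
          + L / 2 * (1 / 2) * (1 - 1 / 2) * (norm (x - h - (x + h)))\<^sup>2"
      by (rule smooth[unfolded strongly_smooth_def, rule_format, OF h]) simp
    moreover have "norm (x - h - (x + h)) = 2 * norm h"
    proof -
      have "x - h - (x + h) = (- 2) *\<^sub>R h"
        by (simp add: scaleR_2)
      then show ?thesis
        by simp
    qed
    moreover have "f x + x' (x - h - x) \<le> f (x - h)"
      using x' h(2) by (rule subdifferentialD)
    ultimately show ?thesis
      unfolding mid by (simp add: blinfun.minus_right power2_eq_square)
  qed
  then have "((\<lambda>t. (f (x + t *\<^sub>R (y - x)) - f x) / t) \<longlongrightarrow> x' (y - x)) (at 0)"
    by (rule quadratic_bound_imp_gateaux_derivative[OF U x x'])
  then have "((\<lambda>t. (f (x + t *\<^sub>R (y - x)) - f x) / t) \<longlongrightarrow> x' (y - x)) (at_right 0)"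
    by (rule filterlim_mono) (auto simp: at_le)
  then have lim: "((\<lambda>t. (f (x + t *\<^sub>R (y - x)) - f x) / t + L / 2 * (1 - t) * (norm (y - x))\<^sup>2)
      \<longlongrightarrow> x' (y - x) + L / 2 * (1 - 0) * (norm (y - x))\<^sup>2) (at_right 0)"
    by (intro tendsto_intros)
  have "\<forall>\<^sub>F t in at_right (0::real). t \<in> {0<..<1}"
    by (rule eventually_at_right_real) simp
  then have "\<forall>\<^sub>F t in at_right (0::real).
      f y - f x \<le> (f (x + t *\<^sub>R (y - x)) - f x) / t + L / 2 * (1 - t) * (norm (y - x))\<^sup>2"
  proof eventually_elim
    case (elim t)
    have "t * f y + (1 - t) * f x
        \<le> f (t *\<^sub>R y + (1 - t) *\<^sub>R x) + L / 2 * t * (1 - t) * (norm (x - y))\<^sup>2"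
      using smooth x y elim unfolding strongly_smooth_def by blast
    moreover have "t *\<^sub>R y + (1 - t) *\<^sub>R x = x + t *\<^sub>R (y - x)"
      by (simp add: algebra_simps)
    ultimately have "t * (f y - f x)
        \<le> f (x + t *\<^sub>R (y - x)) - f x + t * (L / 2 * (1 - t) * (norm (y - x))\<^sup>2)"
      by (simp add: algebra_simps norm_minus_commute)
    also have "\<dots> = t * ((f (x + t *\<^sub>R (y - x)) - f x) / t
        + L / 2 * (1 - t) * (norm (y - x))\<^sup>2)"
      using elim by (simp add: distrib_left)
    finally show ?case
      using elim by simp
  qed
  with lim have "f y - f x \<le> x' (y - x) + L / 2 * (1 - 0) * (norm (y - x))\<^sup>2"
    by (rule tendsto_lowerbound) (rule trivial_limit_at_right_real)
  then show "f y \<le> f x + x' (y - x) + L / 2 * (norm (y - x))\<^sup>2"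
    by simp
qed

text \<open>
  In the average of the descent inequalities from \<open>z = t *\<^sub>R x + (1 - t) *\<^sub>R y\<close> to
  \<open>x\<close> and to \<open>y\<close> the linear terms cancel.
\<close>
lemma descent_imp_strongly_smooth:
  fixes U :: "'a::real_normed_vector set" and f :: "'a \<Rightarrow> real"
  assumes U: "convex U" and ne: "\<And>x. x \<in> U \<Longrightarrow> \<exists>x'. x' \<in> subdifferential U f x"
    and descent: "descent_property U f L"
  shows "strongly_smooth U f L"
  unfolding strongly_smooth_def
proof (intro ballI)
  fix x y and t :: real assume x: "x \<in> U" and y: "y \<in> U" and t: "t \<in> {0<..<1}"
  define z where "z = t *\<^sub>R x + (1 - t) *\<^sub>R y"
  have z: "z \<in> U"
    unfolding z_def using U x y t by (intro convexD) auto
  then obtain z' where z': "z' \<in> subdifferential U f z"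
    using ne by blast
  have xz: "x - z = (1 - t) *\<^sub>R (x - y)" and yz: "y - z = (- t) *\<^sub>R (x - y)"
    by (simp_all add: z_def algebra_simps)
  have "f x \<le> f z + z' (x - z) + L / 2 * (norm (x - z))\<^sup>2"
    and "f y \<le> f z + z' (y - z) + L / 2 * (norm (y - z))\<^sup>2"
    using descent x y z z' unfolding descent_property_def by blast+
  then have "t * f x + (1 - t) * f y
      \<le> t * (f z + z' (x - z) + L / 2 * (norm (x - z))\<^sup>2)
        + (1 - t) * (f z + z' (y - z) + L / 2 * (norm (y - z))\<^sup>2)"
    using t by (intro add_mono mult_left_mono) auto
  also have "\<dots> = f z + L / 2 * t * (1 - t) * (norm (x - y))\<^sup>2"
    unfolding xz yz blinfun.scaleR_right norm_scaleR power_mult_distrib power2_abs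
    by (simp add: power2_eq_square field_simps)
  finally show "t * f x + (1 - t) * f y
      \<le> f (t *\<^sub>R x + (1 - t) *\<^sub>R y) + L / 2 * t * (1 - t) * (norm (y - x))\<^sup>2"
    by (simp add: z_def norm_minus_commute)
qed

text \<open>
  Along the segment from \<open>x\<close> to \<open>y\<close> the derivative of \<open>f\<close> exceeds its initial value
  \<open>x' h\<close> by at most \<open>L * t * (norm h)\<^sup>2\<close>. So \<open>\<psi>\<close>, which subtracts from
  \<open>f\<close> the integral of the resulting upper bound for the derivative, is nonincreasing.
\<close>
lemma upper_monotone_imp_descent:
  fixes U :: "'a::real_normed_vector set" and f :: "'a \<Rightarrow> real"
  assumes U: "open U" "convex U" and ne: "\<And>x. x \<in> U \<Longrightarrow> \<exists>x'. x' \<in> subdifferential U f x"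
    and mono: "subdiff_upper_monotone U f L"
  shows "descent_property U f L"
  unfolding descent_property_def
proof (intro ballI)
  fix x y x' assume x: "x \<in> U" and y: "y \<in> U" and x': "x' \<in> subdifferential U f x"
  define h where "h = y - x"
  define \<psi> where "\<psi> = (\<lambda>t. f (x + t *\<^sub>R h) - t * x' h - L / 2 * t\<^sup>2 * (norm h)\<^sup>2)"
  have "\<psi> 1 \<le> \<psi> 0"
  proof (rule DERIV_nonpos_imp_nonincreasing[where f = \<psi>])
    fix t :: real assume t: "0 \<le> t" "t \<le> 1"
    define z where "z = x + t *\<^sub>R h"
    have z: "z \<in> U"
      using convexD_alt[OF U(2) x y t] by (simp add: z_def h_def algebra_simps)
    \<comment> \<open>Upper monotonicity is void for two subgradients at the same point; at \<open>t = 0\<close>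
        the given \<open>x'\<close> itself is chosen.\<close>
    obtain z' where z': "z' \<in> subdifferential U f z" and le: "z' h \<le> x' h + L * t * (norm h)\<^sup>2"
    proof (cases "t = 0")
      case True
      then show thesis
        using x' by (intro that[of x']) (simp_all add: z_def)
    next
      case False
      obtain z' where z': "z' \<in> subdifferential U f z"
        using ne[OF z] by blast
      have "(z' - x') (z - x) \<le> L * (norm (z - x))\<^sup>2"
        using mono x x' z z' unfolding subdiff_upper_monotone_def graph_subdifferential_def by blast
      then have "t * (z' h - x' h) \<le> t * (L * t * (norm h)\<^sup>2)"
        by (simp add: z_def blinfun.scaleR_right blinfun.diff_left power2_eq_square algebra_simps)
      then have "z' h \<le> x' h + L * t * (norm h)\<^sup>2"
        using False t by simp
      with z' show thesis
        by (rule that)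
    qed
    have "((\<lambda>s. (f (z + s *\<^sub>R h) - f z) / s) \<longlongrightarrow> z' h) (at 0)"
      using upper_monotone_imp_gateaux_derivative[OF U(1) ne mono z z'] .
    then have "((\<lambda>t. f (x + t *\<^sub>R h)) has_real_derivative z' h) (at t)"
      by (simp add: DERIV_def z_def scaleR_add_left add.assoc)
    then have "(\<psi> has_real_derivative z' h - x' h - L * t * (norm h)\<^sup>2) (at t)"
      unfolding \<psi>_def by (auto intro!: derivative_eq_intros)
    with le show "\<exists>d. (\<psi> has_real_derivative d) (at t) \<and> d \<le> 0"
      by (intro exI[of _ "z' h - x' h - L * t * (norm h)\<^sup>2"]) simp
  qed simp
  then show "f y \<le> f x + x' (y - x) + L / 2 * (norm (y - x))\<^sup>2"
    by (simp add: \<psi>_def h_def)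
qed

lemma cocoercive_imp_lipschitz:
  assumes "L > 0" "subdiff_cocoercive U f L"
  shows "subdiff_lipschitz U f L"
  unfolding subdiff_lipschitz_def
proof (clarify)
  fix x x' y y'
  assume "(x, x') \<in> graph_subdifferential U f" "(y, y') \<in> graph_subdifferential U f"
  then have "1 / L * (norm (y' - x'))\<^sup>2 \<le> (y' - x') (y - x)"
    using assms(2) unfolding subdiff_cocoercive_def by blast
  also have "\<dots> \<le> norm (y' - x') * norm (y - x)"
    using norm_blinfun[of "y' - x'" "y - x"] by simp
  finally have "norm (y' - x') * norm (y' - x') \<le> norm (y' - x') * (L * norm (y - x))"
    using assms(1) by (simp add: power2_eq_square field_simps)
  then show "norm (y' - x') \<le> L * norm (y - x)"
    using assms(1) by (cases "y' = x'") simp_all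
qed

lemma lipschitz_imp_upper_monotone:
  assumes "subdiff_lipschitz U f L"
  shows "subdiff_upper_monotone U f L"
  unfolding subdiff_upper_monotone_def
proof (clarify)
  fix x x' y y'
  assume "(x, x') \<in> graph_subdifferential U f" "(y, y') \<in> graph_subdifferential U f"
  then have "norm (y' - x') \<le> L * norm (y - x)"
    using assms unfolding subdiff_lipschitz_def by blast
  then have "norm (y' - x') * norm (y - x) \<le> L * norm (y - x) * norm (y - x)"
    by (rule mult_right_mono) simp
  then show "(y' - x') (y - x) \<le> L * (norm (y - x))\<^sup>2"
    using norm_blinfun[of "y' - x'" "y - x"] by (simp add: power2_eq_square mult.assoc)
qed

text \<open>Add the inequality for \<open>(x, y)\<close> to the one for \<open>(y, x)\<close>.\<close>
lemma improved_subgradient_imp_cocoercive: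
  assumes "improved_subgradient_inequality U f L"
  shows "subdiff_cocoercive U f L"
  unfolding subdiff_cocoercive_def
proof (clarify)
  fix x x' y y'
  assume xy: "(x, x') \<in> graph_subdifferential U f" "(y, y') \<in> graph_subdifferential U f"
  have "f x + x' (y - x) + 1 / (2 * L) * (norm (y' - x'))\<^sup>2 \<le> f y"
    and "f y + y' (x - y) + 1 / (2 * L) * (norm (x' - y'))\<^sup>2 \<le> f x"
    using assms xy unfolding improved_subgradient_inequality_def by blast+
  then show "1 / L * (norm (y' - x'))\<^sup>2 \<le> (y' - x') (y - x)"
    by (simp add: norm_minus_commute[of x' y'] blinfun.diff_left blinfun.diff_right)
qed


section \<open>From the descent lemma to cocoercivity\<close>

lemma blinfun_norm_mult_radius_le:
  fixes g :: "'a::real_normed_vector \<Rightarrow>\<^sub>L real"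
  assumes r: "r \<ge> 0" and le: "\<And>d. norm d \<le> r \<Longrightarrow> g d \<le> C"
  shows "norm g * r \<le> C"
proof (cases "r = 0")
  case True
  then show ?thesis
    using le[of 0] by simp
next
  case False
  have "norm g \<le> C / r"
  proof (rule norm_blinfun_bound)
    show "0 \<le> C / r"
      using le[of 0] r by simp
    fix h :: 'a
    have le': "g k \<le> C / r * norm k" for k
    proof (cases "k = 0")
      case nz: False
      have "g ((r / norm k) *\<^sub>R k) \<le> C"
        using nz r by (intro le) simp
      then show ?thesis
        using nz r False by (simp add: blinfun.scaleR_right field_simps)
    qed simp
    show "norm (g h) \<le> C / r * norm h"
      using le'[of h] le'[of "- h"] by (simp add: blinfun.minus_right)
  qed
  then show ?thesis
    using r False by (simp add: field_simps)
qed

text \<open>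
  At \<open>y - d\<close> the function lies above the affine minorant given by \<open>x'\<close> and below the quadratic
  majorant given by \<open>y'\<close>. This bounds \<open>(y' - x') d\<close>; the supremum over the ball of radius
  \<open>r\<close> turns it into a bound of the norm. The right-hand side contains the gap in the subgradient
  inequality from \<open>x\<close> to \<open>y\<close>, which the estimate bounds from below.
\<close>
lemma descent_imp_subgradient_gap_radius:
  fixes U :: "'a::real_normed_vector set" and f :: "'a \<Rightarrow> real"
  assumes L: "L > 0" and descent: "descent_property U f L"
    and x': "x' \<in> subdifferential U f x"
    and y: "y \<in> U" and y': "y' \<in> subdifferential U f y"
    and r: "r \<ge> 0" "cball y r \<subseteq> U"
  shows "norm (y' - x') * r \<le> f y - f x - x' (y - x) + L / 2 * r\<^sup>2"
proof (rule blinfun_norm_mult_radius_le[OF r(1)])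
  fix d :: 'a assume d: "norm d \<le> r"
  then have yd: "y - d \<in> U"
    using r(2) by (auto simp: dist_norm)
  have "f x + x' (y - d - x) \<le> f (y - d)"
    using x' yd by (rule subdifferentialD)
  also have "\<dots> \<le> f y + y' (y - d - y) + L / 2 * (norm (y - d - y))\<^sup>2"
    using descent y yd y' unfolding descent_property_def by blast
  also have "\<dots> \<le> f y - y' d + L / 2 * r\<^sup>2"
    using L d by (simp add: blinfun.minus_right power_mono)
  finally show "(y' - x') d \<le> f y - f x - x' (y - x) + L / 2 * r\<^sup>2"
    by (simp add: blinfun.diff_left blinfun.diff_right)
qed

text \<open>
  The previous estimate is used with two radii. The optimal one is \<open>norm (y' - x') / L\<close>, which
  produces the claim. That it is admissible, i.e. at most \<open>\<rho>\<close>, follows from the estimate with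
  radius \<open>\<rho>\<close> once the gap is bounded above by the descent inequality. Keeping \<open>\<rho>\<close> separate
  from \<open>norm (y - x)\<close> covers the case \<open>x = y\<close>, where it forces \<open>x' = y'\<close>.
\<close>
lemma descent_imp_improved_subgradient_local:
  fixes U :: "'a::real_normed_vector set" and f :: "'a \<Rightarrow> real"
  assumes L: "L > 0" and descent: "descent_property U f L"
    and x: "x \<in> U" and x': "x' \<in> subdifferential U f x"
    and y: "y \<in> U" and y': "y' \<in> subdifferential U f y"
    and \<rho>: "\<rho> > 0" "norm (y - x) \<le> \<rho>" "cball y \<rho> \<subseteq> U"
  shows "f x + x' (y - x) + 1 / (2 * L) * (norm (y' - x'))\<^sup>2 \<le> f y"
proof -
  note gap = descent_imp_subgradient_gap_radius[OF L descent x' y y']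
  have "f y - f x - x' (y - x) \<le> L / 2 * (norm (y - x))\<^sup>2"
    using descent x y x' by (force simp: descent_property_def)
  also have "\<dots> \<le> L / 2 * \<rho>\<^sup>2"
    using L \<rho> by (intro mult_left_mono power_mono) simp_all
  finally have "norm (y' - x') * \<rho> \<le> L * \<rho>\<^sup>2"
    using gap[of \<rho>] \<rho> by simp
  then have "norm (y' - x') \<le> L * \<rho>"
    using \<rho>(1) by (simp add: power2_eq_square flip: mult.assoc)
  then have "norm (y' - x') / L \<le> \<rho>"
    using L by (simp add: divide_le_eq mult.commute)
  then have "cball y (norm (y' - x') / L) \<subseteq> U"
    using \<rho>(3) by (meson order_trans subset_cball)
  then have "norm (y' - x') * (norm (y' - x') / L)
      \<le> f y - f x - x' (y - x) + L / 2 * (norm (y' - x') / L)\<^sup>2"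
    using L by (intro gap) simp_all
  then show ?thesis
    using L by (simp add: power2_eq_square field_simps)
qed

lemma descent_imp_improved_subgradient_UNIV:
  fixes f :: "'a::real_normed_vector \<Rightarrow> real"
  assumes "L > 0" "descent_property UNIV f L"
  shows "improved_subgradient_inequality UNIV f L"
  unfolding improved_subgradient_inequality_def graph_subdifferential_def
proof (clarify)
  fix x x' y y'
  assume "x' \<in> subdifferential UNIV f x" "y' \<in> subdifferential UNIV f y"
  then show "f x + x' (y - x) + 1 / (2 * L) * (norm (y' - x'))\<^sup>2 \<le> f y"
    \<comment> \<open>The summand \<open>1\<close> keeps the radius positive when \<open>x = y\<close>.\<close>
    using assms descent_imp_improved_subgradient_local[of L UNIV f x x' y y' "norm (y - x) + 1"]
    by (simp add: add_nonneg_pos)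
qed

lemma descent_imp_cocoercive_local:
  fixes U :: "'a::real_normed_vector set" and f :: "'a \<Rightarrow> real"
  assumes L: "L > 0" and descent: "descent_property U f L"
    and x: "x \<in> U" and x': "x' \<in> subdifferential U f x"
    and y: "y \<in> U" and y': "y' \<in> subdifferential U f y"
    and \<rho>: "\<rho> > 0" "norm (y - x) \<le> \<rho>" "cball x \<rho> \<subseteq> U" "cball y \<rho> \<subseteq> U"
  shows "(norm (y' - x'))\<^sup>2 \<le> L * (y' - x') (y - x)"
proof -
  have "f x + x' (y - x) + 1 / (2 * L) * (norm (y' - x'))\<^sup>2 \<le> f y"
    using assms by (intro descent_imp_improved_subgradient_local)
  moreover have "f y + y' (x - y) + 1 / (2 * L) * (norm (x' - y'))\<^sup>2 \<le> f x"
    using assms by (intro descent_imp_improved_subgradient_local) (simp_all add: norm_minus_commute)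
  ultimately have "1 / L * (norm (y' - x'))\<^sup>2 \<le> (y' - x') (y - x)"
    by (simp add: norm_minus_commute[of x' y'] blinfun.diff_left blinfun.diff_right)
  then show ?thesis
    using L by (simp add: field_simps)
qed

text \<open>
  By compactness, all points of the segment from \<open>x\<close> to \<open>y\<close> are centres of balls in \<open>U\<close> of
  a common radius \<open>\<rho>\<close>. Subdividing into \<open>n\<close> equal steps shorter than \<open>\<rho>\<close> makes the local
  version applicable to consecutive points. Every step is \<open>h\<close> divided by \<open>n\<close>, so the right-hand
  sides are values of the increments at the same vector and add up without loss, whereas on the left
  \<open>(\<Sum>k<n. norm (\<delta> k))\<^sup>2 \<le> n * (\<Sum>k<n. (norm (\<delta> k))\<^sup>2)\<close>.
\<close>
lemma descent_imp_cocoercive: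
  fixes U :: "'a::real_normed_vector set" and f :: "'a \<Rightarrow> real"
  assumes U: "open U" "convex U" and ne: "\<And>x. x \<in> U \<Longrightarrow> \<exists>x'. x' \<in> subdifferential U f x"
    and L: "L > 0" and descent: "descent_property U f L"
  shows "subdiff_cocoercive U f L"
  unfolding subdiff_cocoercive_def graph_subdifferential_def
proof (clarify)
  fix x x' y y'
  assume x: "x \<in> U" "x' \<in> subdifferential U f x" and y: "y \<in> U" "y' \<in> subdifferential U f y"
  define h where "h = y - x"
  have seg: "closed_segment x y \<subseteq> U"
    using U(2) x(1) y(1) by (rule closed_segment_subset[OF _ _ , rotated 2])
  obtain \<rho> where \<rho>: "\<rho> > 0" "(\<Union>z\<in>closed_segment x y. cball z \<rho>) \<subseteq> U"
    using compact_subset_open_imp_cball_epsilon_subset[OF compact_segment U(1) seg] by blast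
  obtain n :: nat where n: "norm h / \<rho> < real n" "n > 0"
    using reals_Archimedean2[of "norm h / \<rho>"] \<rho>(1)
    by (metis divide_nonneg_pos gr0I norm_ge_zero not_less of_nat_0)
  define p where "p = (\<lambda>k::nat. x + (real k / real n) *\<^sub>R h)"
  have p: "p k \<in> U" "cball (p k) \<rho> \<subseteq> U" if "k \<le> n" for k
  proof -
    have "p k \<in> closed_segment x y"
      using that n(2) by (auto simp: p_def h_def in_segment algebra_simps intro!: exI[of _ "real k / real n"])
    then show "p k \<in> U" "cball (p k) \<rho> \<subseteq> U"
      using seg \<rho>(2) by auto
  qed
  \<comment> \<open>Arbitrary subgradients at the intermediate points, the given ones at the two ends.\<close>
  have "\<forall>k. \<exists>g. k \<le> n \<longrightarrow> g \<in> subdifferential U f (p k) \<and> (k = 0 \<longrightarrow> g = x') \<and> (k = n \<longrightarrow> g = y')"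
  proof
    fix k
    have "p 0 = x" "p n = y"
      using n(2) by (simp_all add: p_def h_def)
    then show "\<exists>g. k \<le> n \<longrightarrow> g \<in> subdifferential U f (p k) \<and> (k = 0 \<longrightarrow> g = x') \<and> (k = n \<longrightarrow> g = y')"
      using x(2) y(2) n(2) ne[OF p(1), of k] by (cases "k = 0"; cases "k = n") auto
  qed
  then obtain g where g: "\<And>k. k \<le> n \<Longrightarrow> g k \<in> subdifferential U f (p k)" "g 0 = x'" "g n = y'"
    by (metis order_refl zero_le)
  define \<delta> where "\<delta> = (\<lambda>k. g (Suc k) - g k)"
  have sum_\<delta>: "y' - x' = (\<Sum>k<n. \<delta> k)"
    using g by (simp add: \<delta>_def sum_lessThan_telescope)
  have step: "real n * (norm (\<delta> k))\<^sup>2 \<le> L * \<delta> k h" if "k < n" for k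
  proof -
    have diff: "p (Suc k) - p k = (1 / real n) *\<^sub>R h"
      by (simp add: p_def add_divide_distrib scaleR_add_left)
    have "norm (p (Suc k) - p k) \<le> \<rho>"
      using n \<rho>(1) unfolding diff by (simp add: field_simps)
    then have "(norm (\<delta> k))\<^sup>2 \<le> L * \<delta> k (p (Suc k) - p k)"
      unfolding \<delta>_def using that \<rho>(1)
      by (intro descent_imp_cocoercive_local[OF L descent, where \<rho> = \<rho>]) (simp_all add: p g)
    then show ?thesis
      using n(2) unfolding diff by (simp add: blinfun.scaleR_right field_simps)
  qed
  have "(norm (y' - x'))\<^sup>2 \<le> (\<Sum>k<n. norm (\<delta> k))\<^sup>2"
    unfolding sum_\<delta> by (intro power_mono norm_sum) simp
  also have "\<dots> \<le> real n * (\<Sum>k<n. (norm (\<delta> k))\<^sup>2)"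
    using sum_squared_le_sum_of_squares[of "\<lambda>k. norm (\<delta> k)" "{..<n}"] by (simp add: mult.commute)
  also have "\<dots> = (\<Sum>k<n. real n * (norm (\<delta> k))\<^sup>2)"
    by (rule sum_distrib_left)
  also have "\<dots> \<le> (\<Sum>k<n. L * \<delta> k h)"
    by (intro sum_mono step) simp
  also have "\<dots> = L * (y' - x') h"
    by (simp add: sum_\<delta> blinfun.sum_left sum_distrib_left)
  finally show "1 / L * (norm (y' - x'))\<^sup>2 \<le> (y' - x') (y - x)"
    using L by (simp add: h_def field_simps)
qed


section \<open>The equivalences\<close>

theorem theorem3p1:
  fixes U :: "'a::banach set" and f :: "'a \<Rightarrow> real" and L :: real
  assumes "open U" and "convex U"
    and "convex_on U f" and "lower_semicontinuous_on U f"
    and "L > 0"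
  defines "i \<equiv> strongly_smooth U f L"
    and "ii \<equiv> descent_property U f L"
    and "iii \<equiv> subdiff_upper_monotone U f L"
    and "iv \<equiv> subdiff_lipschitz U f L"
    and "v \<equiv> subdiff_cocoercive U f L"
    and "vi \<equiv> improved_subgradient_inequality U f L"
  shows "(i \<or> ii \<or> iii \<or> iv \<or> v \<or> vi \<longrightarrow> gateaux_differentiable_on U f)
    \<and> (iv \<longrightarrow> (\<forall>x\<in>U. \<exists>!x'. x' \<in> subdifferential U f x))
    \<and> ((i \<longleftrightarrow> ii) \<and> (ii \<longleftrightarrow> iii) \<and> (iii \<longleftrightarrow> iv) \<and> (vi \<longrightarrow> v) \<and> (v \<longrightarrow> i))
    \<and> (hilbert_space TYPE('a) \<longrightarrow>
         (i \<longleftrightarrow> ii) \<and> (ii \<longleftrightarrow> iii) \<and> (iii \<longleftrightarrow> iv) \<and> (iv \<longleftrightarrow> v) \<and> (vi \<longrightarrow> i \<and> ii \<and> iii \<and> iv \<and> v))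
    \<and> (U = UNIV \<longrightarrow>
         (i \<longleftrightarrow> ii) \<and> (ii \<longleftrightarrow> iii) \<and> (iii \<longleftrightarrow> iv) \<and> (iv \<longleftrightarrow> v) \<and> (v \<longleftrightarrow> vi))"
proof -
  have ne: "\<exists>x'. x' \<in> subdifferential U f x" if "x \<in> U" for x
    using subdifferential_nonempty[OF assms(1,3,4) that] by blast
  have i_ii: "i \<Longrightarrow> ii"
    unfolding i_def ii_def by (rule strongly_smooth_imp_descent[OF assms(1)])
  have ii_i: "ii \<Longrightarrow> i"
    unfolding i_def ii_def by (rule descent_imp_strongly_smooth[OF assms(2) ne])
  have ii_v: "ii \<Longrightarrow> v"
    unfolding ii_def v_def by (rule descent_imp_cocoercive[OF assms(1,2) ne assms(5)])
  have v_iv: "v \<Longrightarrow> iv"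
    unfolding v_def iv_def by (rule cocoercive_imp_lipschitz[OF assms(5)])
  have iv_iii: "iv \<Longrightarrow> iii"
    unfolding iv_def iii_def by (rule lipschitz_imp_upper_monotone)
  have iii_ii: "iii \<Longrightarrow> ii"
    unfolding iii_def ii_def by (rule upper_monotone_imp_descent[OF assms(1,2) ne])
  have vi_v: "vi \<Longrightarrow> v"
    unfolding vi_def v_def by (rule improved_subgradient_imp_cocoercive)
  have ii_vi: "vi" if "U = UNIV" "ii"
    using descent_imp_improved_subgradient_UNIV[OF assms(5)] that by (simp add: ii_def vi_def)
  have gateaux: "gateaux_differentiable_on U f" if "iii"
    unfolding gateaux_differentiable_on_def
  proof
    fix x assume x: "x \<in> U"
    then obtain x' where "x' \<in> subdifferential U f x"
      using ne by blast
    with upper_monotone_imp_gateaux_derivative[OF assms(1) ne _ x] that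
    show "\<exists>D :: 'a \<Rightarrow>\<^sub>L real. \<forall>h. ((\<lambda>t. (f (x + t *\<^sub>R h) - f x) / t) \<longlongrightarrow> D h) (at 0)"
      unfolding iii_def by blast
  qed
  have unique: "\<exists>!x'. x' \<in> subdifferential U f x" if "iv" "x \<in> U" for x
  proof (rule ex_ex1I[OF ne[OF that(2)]])
    fix x' y' assume "x' \<in> subdifferential U f x" "y' \<in> subdifferential U f x"
    then have "norm (y' - x') \<le> L * norm (x - x)"
      using that unfolding iv_def subdiff_lipschitz_def graph_subdifferential_def by blast
    then show "x' = y'"
      by simp
  qed
  show ?thesis
    using i_ii ii_i ii_v v_iv iv_iii iii_ii vi_v ii_vi gateaux unique by blast
qed

end
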